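(* Let $N$ be a positive integer, let $A_0,A_1,A_2,A_3,B_0,B_1,D_0,D_1,D_2,E,F_0,F_1,F_2,F_3,F_4,G_0,G_1,G_2,G_3$ be arbitrary (possibly complex) time-independent constants, and let $\psi(z,t)=z^N+\sum_{m=1}^Nc_m(t)z^{N-m}$ be a time-dependent monic polynomial of degree $N$ in $z$. If $\psi$ evolves according to the linear partial differential equation $$\psi_{tt}+\{E-(N-1)[D_2+(N-2)G_3]z\}\psi_t+(G_0+G_1z+G_2z^2+G_3z^3)\psi_{zzt}+(D_0+D_1z+D_2z^2)\psi_{zt}$$ $$+(F_0+F_1z+F_2z^2+F_3z^3+F_4z^4)\psi_{zzz}+(A_0+A_1z+A_2z^2+A_3z^3)\psi_{zz}$$ $$+\{B_0+B_1z-(N-1)[2A_3+3(N-2)F_4]z^2\}\psi_z$$ $$+N\{-B_1-(N-1)[A_2+(N-2)F_3]+(N-1)[A_3+2(N-2)F_4]z\}\psi=0,$$ then its $N$ coefficients $c_m(t)$ evolve according to the following system of $N$ linear ordinary differential equations, with $c_0=1$ and $c_m=0$ for $m<0$ and for $m>N$: $$\ddot c_m+(N+2-m)(N+1-m)G_0\dot c_{m-2}+(N+1-m)[D_0+(N-m)G_1]\dot c_{m-1}$$ $$+\{E+(N-m)[D_1+(N-1-m)G_2]\}\dot c_m-m[D_2+(2N-3-m)G_3]\dot c_{m+1}$$ $$+(N+3-m)(N+2-m)(N+1-m)F_0c_{m-3}+(N+2-m)(N+1-m)[A_0+(N-m)F_1]c_{m-2}$$ $$+(N+1-m)\{(N-m)[A_1+(N-1-m)F_2]+B_0\}c_{m-1}$$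 $$-m\{(2N-1-m)A_2+B_1+[3N^2-6N+2-3(N-1)m+m^2]F_3\}c_m$$ $$+m(m+1)[A_3+(3N-5-m)F_4]c_{m+1}=0,\qquad m=1,\dots,N.$$
   Context: Dots denote derivatives with respect to $t$ (time); subscripts $z$ and $t$ on $\psi$ denote partial derivatives. *)

theory Defs
  imports "HOL-Analysis.Analysis"
begin

definition tder :: "(real \<Rightarrow> complex) \<Rightarrow> real \<Rightarrow> complex" where
  "tder f t = vector_derivative f (at t)"

definition twice_differentiable_on :: "(real \<Rightarrow> complex) \<Rightarrow> real set \<Rightarrow> bool" where
  "twice_differentiable_on f T \<longleftrightarrow>
     (\<forall>t\<in>T. f differentiable (at t)) \<and> (\<forall>t\<in>T. tder f differentiable (at t))"

definition pd_z :: "(complex \<Rightarrow> real \<Rightarrow> complex) \<Rightarrow> complex \<Rightarrow> real \<Rightarrow> complex" where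
  "pd_z \<psi> z t = deriv (\<lambda>w. \<psi> w t) z"

definition pd_t :: "(complex \<Rightarrow> real \<Rightarrow> complex) \<Rightarrow> complex \<Rightarrow> real \<Rightarrow> complex" where
  "pd_t \<psi> z t = tder (\<lambda>s. \<psi> z s) t"

(* The values c m are only used for 1 \<le> m \<le> N; the boundary conventions
   c_0 = 1 and c_m = 0 for m < 0 and for m > N are built in here. *)
definition coeff_ext :: "nat \<Rightarrow> (nat \<Rightarrow> real \<Rightarrow> complex) \<Rightarrow> int \<Rightarrow> real \<Rightarrow> complex" where
  "coeff_ext N c m t =
     (if m = 0 then 1 else if 1 \<le> m \<and> m \<le> int N then c (nat m) t else 0)"

end

theory Submission
  imports Defs "HOL-Computational_Algebra.Polynomial"
begin

text \<open>For fixed \<open>t\<close> the function \<open>\<psi> z t\<close> is a polynomial in \<open>z\<close>, and time derivatives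
  act on its coefficients. The equation therefore says that a polynomial vanishes identically, and
  the system for the \<open>c m\<close> consists of its coefficients of \<open>z ^ (N - m)\<close>. Indexing coefficients by
  integers, with zeros at the negative indices, makes the rules for \<open>pderiv\<close> and for
  multiplication by \<open>z\<close> hold without boundary cases.\<close>

definition int_coeff :: "'a::zero poly \<Rightarrow> int \<Rightarrow> 'a" where
  "int_coeff p i = (if i < 0 then 0 else coeff p (nat i))"

lemma int_coeff_0 [simp]: "int_coeff 0 i = 0"
  by (simp add: int_coeff_def)

lemma int_coeff_add [simp]: "int_coeff (p + q) i = int_coeff p i + int_coeff q i"
  by (simp add: int_coeff_def)

lemma int_coeff_smult [simp]: "int_coeff (smult a p) i = a * int_coeff p i"
  by (simp add: int_coeff_def)

lemma int_coeff_minus [simp]: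
  fixes p :: "'a::ab_group_add poly"
  shows "int_coeff (- p) i = - int_coeff p i"
  by (simp add: int_coeff_def)

text \<open>Expanding a product with an explicit polynomial such as \<open>[:a, b, c:] * p\<close>
  leaves only \<open>smult\<close> and \<open>pCons 0\<close>, so this shift is all that is needed
  for the powers of z in the equation.\<close>

lemma int_coeff_pCons_0 [simp]: "int_coeff (pCons 0 p) i = int_coeff p (i - 1)"
proof (cases "i \<le> 0")
  case True
  then show ?thesis by (cases "i = 0") (auto simp: int_coeff_def)
next
  case False
  then have "nat i = Suc (nat (i - 1))" by simp
  with False show ?thesis by (simp add: int_coeff_def)
qed

text \<open>The delicate index is -1, where the constant coefficient of \<open>p\<close> appears on
  the right; there the factor i + 1 is zero.\<close>

lemma int_coeff_pderiv [simp]: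
  fixes p :: "complex poly"
  shows "int_coeff (pderiv p) i = of_int (i + 1) * int_coeff p (i + 1)"
proof (cases "i < 0")
  case True
  then show ?thesis by (cases "i = -1") (auto simp: int_coeff_def)
next
  case False
  then have "nat (i + 1) = Suc (nat i)" "(of_nat (nat i) :: complex) = of_int i" by simp_all
  with False show ?thesis by (simp add: int_coeff_def coeff_pderiv add.commute)
qed

text \<open>The argument of \<open>F\<close> counts down from the top degree, as the index of c_m
  does. Integer arguments let \<open>coeff_ext N c\<close> be inserted directly.\<close>

definition rev_poly :: "nat \<Rightarrow> (int \<Rightarrow> complex) \<Rightarrow> complex poly" where
  "rev_poly N F = (\<Sum>i\<le>N. smult (F (int N - int i)) (monom 1 i))"

text \<open>Powers above N correspond to negative arguments of \<open>F\<close>, and negative powers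
  to arguments above N, so the two assumptions cover the two ends.\<close>

lemma int_coeff_rev_poly:
  assumes "\<And>m. m < 0 \<Longrightarrow> F m = 0" "\<And>m. m > int N \<Longrightarrow> F m = 0"
  shows "int_coeff (rev_poly N F) i = F (int N - i)"
proof -
  have "coeff (rev_poly N F) j = F (int N - int j)" for j
    using assms(1)[of "int N - int j"]
    by (simp add: rev_poly_def coeff_sum if_distrib[of "\<lambda>x. _ * x"] sum.delta' cong: if_cong)
  then show ?thesis
    using assms(2)[of "int N - i"] by (auto simp: int_coeff_def)
qed

text \<open>Separates the variables: when \<open>F\<close> depends on time, the remaining factors
  depend on z alone and are constants for the time derivative.\<close>

lemma poly_pderiv_rev_poly:
  "poly ((pderiv ^^ k) (rev_poly N F)) z =
     (\<Sum>i\<le>N. F (int N - int i) * poly ((pderiv ^^ k) (monom 1 i)) z)"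
  by (simp add: rev_poly_def higher_pderiv_sum higher_pderiv_smult poly_sum)

text \<open>Since T is open, agreement of \<phi> with the polynomial on T determines its time
  derivative at t. The parameter \<open>k\<close> serves the mixed derivatives as well.\<close>

lemma pd_t_poly_pderiv_rev_poly:
  assumes "open T" "t \<in> T"
    and diff: "\<And>m. F m differentiable (at t)"
    and \<phi>: "\<And>s. s \<in> T \<Longrightarrow> \<phi> z s = poly ((pderiv ^^ k) (rev_poly N (\<lambda>m. F m s))) z"
  shows "pd_t \<phi> z t = poly ((pderiv ^^ k) (rev_poly N (\<lambda>m. tder (F m) t))) z"
proof -
  have "(F m has_vector_derivative tder (F m) t) (at t)" for m
    using diff by (simp add: tder_def vector_derivative_works)
  then have "((\<lambda>s. \<Sum>i\<le>N. F (int N - int i) s * poly ((pderiv ^^ k) (monom 1 i)) z)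
      has_vector_derivative
      (\<Sum>i\<le>N. tder (F (int N - int i)) t * poly ((pderiv ^^ k) (monom 1 i)) z)) (at t)"
    by (intro has_vector_derivative_sum has_vector_derivative_mult_left)
  then have "((\<lambda>s. \<phi> z s) has_vector_derivative
      (\<Sum>i\<le>N. tder (F (int N - int i)) t * poly ((pderiv ^^ k) (monom 1 i)) z)) (at t)"
    by (rule has_vector_derivative_transform_within_open[OF _ assms(1,2)])
      (simp add: \<phi> poly_pderiv_rev_poly)
  then show ?thesis
    by (simp add: pd_t_def tder_def poly_pderiv_rev_poly vector_derivative_at)
qed

lemma pd_z_poly:
  assumes "\<And>w. \<phi> w t = poly p w"
  shows "pd_z \<phi> z t = poly (pderiv p) z"
  using assms by (simp add: pd_z_def DERIV_imp_deriv)

lemma coeff_ext_eq_const: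
  assumes "m \<le> 0 \<or> m > int N"
  shows "coeff_ext N c m = (\<lambda>t. if m = 0 then 1 else 0)"
  using assms by (auto simp: coeff_ext_def fun_eq_iff)

lemma coeff_ext_eq_coeff:
  assumes "1 \<le> m" "m \<le> int N"
  shows "coeff_ext N c m = c (nat m)"
  using assms by (auto simp: coeff_ext_def fun_eq_iff)

lemma tder_const [simp]: "tder (\<lambda>t. a) = (\<lambda>t. 0)"
  by (simp add: fun_eq_iff tder_def)

lemma twice_differentiable_coeff_ext:
  assumes "\<And>m. m \<in> {1..N} \<Longrightarrow> twice_differentiable_on (c m) T"
  shows "twice_differentiable_on (coeff_ext N c m) T"
proof (cases "1 \<le> m \<and> m \<le> int N")
  case True
  then have "nat m \<in> {1..N}" by auto
  with True show ?thesis using assms by (simp add: coeff_ext_eq_coeff)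
next
  case False
  then have "coeff_ext N c m = (\<lambda>t. if m = 0 then 1 else 0)"
    by (intro coeff_ext_eq_const) auto
  then show ?thesis by (simp add: twice_differentiable_on_def)
qed

lemma poly_rev_poly_coeff_ext:
  "poly (rev_poly N (\<lambda>m. coeff_ext N c m t)) z = z ^ N + (\<Sum>m=1..N. c m t * z ^ (N - m))"
proof -
  have "poly (rev_poly N (\<lambda>m. coeff_ext N c m t)) z =
          (\<Sum>i\<le>N. coeff_ext N c (int N - int i) t * z ^ i)"
    by (simp add: rev_poly_def poly_sum poly_monom)
  also have "\<dots> = (\<Sum>m\<le>N. coeff_ext N c (int m) t * z ^ (N - m))"
    by (rule sum.reindex_bij_witness[of _ "\<lambda>m. N - m" "\<lambda>m. N - m"]) auto
  also have "{..N} = insert 0 {1..N}" by auto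
  also have "(\<Sum>m\<in>insert 0 {1..N}. coeff_ext N c (int m) t * z ^ (N - m)) =
               z ^ N + (\<Sum>m=1..N. c m t * z ^ (N - m))"
    by (simp add: coeff_ext_def)
  finally show ?thesis .
qed

theorem mainTheorem2:
  fixes N :: nat
    and A0 A1 A2 A3 B0 B1 D0 D1 D2 E F0 F1 F2 F3 F4 G0 G1 G2 G3 :: complex
    and T :: "real set"
    and c :: "nat \<Rightarrow> real \<Rightarrow> complex"
    and \<psi> :: "complex \<Rightarrow> real \<Rightarrow> complex"
  assumes N_pos: "N > 0"
    and open_T: "open T"
    and c_diff: "\<And>m. m \<in> {1..N} \<Longrightarrow> twice_differentiable_on (c m) T"
    and psi_def: "\<And>z t. t \<in> T \<Longrightarrow> \<psi> z t = z ^ N + (\<Sum>m=1..N. c m t * z ^ (N - m))"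
    and pde: "\<And>z t. t \<in> T \<Longrightarrow>
      (let n = (of_nat N :: complex) in
         pd_t (pd_t \<psi>) z t
       + (E - (n - 1) * (D2 + (n - 2) * G3) * z) * pd_t \<psi> z t
       + (G0 + G1 * z + G2 * z^2 + G3 * z^3) * pd_t (pd_z (pd_z \<psi>)) z t
       + (D0 + D1 * z + D2 * z^2) * pd_t (pd_z \<psi>) z t
       + (F0 + F1 * z + F2 * z^2 + F3 * z^3 + F4 * z^4) * pd_z (pd_z (pd_z \<psi>)) z t
       + (A0 + A1 * z + A2 * z^2 + A3 * z^3) * pd_z (pd_z \<psi>) z t
       + (B0 + B1 * z - (n - 1) * (2 * A3 + 3 * (n - 2) * F4) * z^2) * pd_z \<psi> z t
       + n * (- B1 - (n - 1) * (A2 + (n - 2) * F3)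
              + (n - 1) * (A3 + 2 * (n - 2) * F4) * z) * \<psi> z t
       = 0)"
  shows "\<forall>k\<in>{1..int N}. \<forall>t\<in>T.
      (let n = (of_nat N :: complex); m = (of_int k :: complex); C = coeff_ext N c in
         tder (tder (C k)) t
       + (n + 2 - m) * (n + 1 - m) * G0 * tder (C (k - 2)) t
       + (n + 1 - m) * (D0 + (n - m) * G1) * tder (C (k - 1)) t
       + (E + (n - m) * (D1 + (n - 1 - m) * G2)) * tder (C k) t
       - m * (D2 + (2 * n - 3 - m) * G3) * tder (C (k + 1)) t
       + (n + 3 - m) * (n + 2 - m) * (n + 1 - m) * F0 * C (k - 3) t
       + (n + 2 - m) * (n + 1 - m) * (A0 + (n - m) * F1) * C (k - 2) t
       + (n + 1 - m) * ((n - m) * (A1 + (n - 1 - m) * F2) + B0) * C (k - 1) t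
       - m * ((2 * n - 1 - m) * A2 + B1
              + (3 * n^2 - 6 * n + 2 - 3 * (n - 1) * m + m^2) * F3) * C k t
       + m * (m + 1) * (A3 + (3 * n - 5 - m) * F4) * C (k + 1) t
       = 0)"
proof (intro ballI, goal_cases)
  case (1 k t)
  then have t: "t \<in> T" by simp
  define C where "C = coeff_ext N c"
  define n where "n = (of_nat N :: complex)"
  define P where "P s = rev_poly N (\<lambda>m. C m s)" for s
  define P1 where "P1 s = rev_poly N (\<lambda>m. tder (C m) s)" for s
  define P2 where "P2 s = rev_poly N (\<lambda>m. tder (tder (C m)) s)" for s
  have diff: "C m differentiable (at s)" "tder (C m) differentiable (at s)" if "s \<in> T" for m s
    using twice_differentiable_coeff_ext[OF c_diff] that
    by (auto simp: C_def twice_differentiable_on_def)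
  have psi: "\<psi> z s = poly (P s) z" if "s \<in> T" for z s
    using psi_def[OF that] by (simp add: P_def C_def poly_rev_poly_coeff_ext)
  have z1: "pd_z \<psi> z s = poly (pderiv (P s)) z" if "s \<in> T" for z s
    by (rule pd_z_poly) (simp add: psi that)
  have z2: "pd_z (pd_z \<psi>) z s = poly (pderiv (pderiv (P s))) z" if "s \<in> T" for z s
    by (rule pd_z_poly) (simp add: z1 that)
  have z3: "pd_z (pd_z (pd_z \<psi>)) z s = poly (pderiv (pderiv (pderiv (P s)))) z"
    if "s \<in> T" for z s
    by (rule pd_z_poly) (simp add: z2 that)
  have t1: "pd_t \<psi> z s = poly (P1 s) z" if "s \<in> T" for z s
    using pd_t_poly_pderiv_rev_poly[OF open_T that, of C \<psi> z 0] diff that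
    by (simp add: P1_def P_def psi)
  \<comment> \<open>The representation \<open>t1\<close> holds on all of T, not just at one time, so
    it can be differentiated once more.\<close>
  have t2: "pd_t (pd_t \<psi>) z s = poly (P2 s) z" if "s \<in> T" for z s
    using pd_t_poly_pderiv_rev_poly[OF open_T that, of "\<lambda>m. tder (C m)" "pd_t \<psi>" z 0] diff that
    by (simp add: P1_def P2_def t1)
  have t1z1: "pd_t (pd_z \<psi>) z s = poly (pderiv (P1 s)) z" if "s \<in> T" for z s
    using pd_t_poly_pderiv_rev_poly[OF open_T that, of C "pd_z \<psi>" z 1] diff that
    by (simp add: P1_def P_def z1)
  have t1z2: "pd_t (pd_z (pd_z \<psi>)) z s = poly (pderiv (pderiv (P1 s))) z" if "s \<in> T" for z s
    using pd_t_poly_pderiv_rev_poly[OF open_T that, of C "pd_z (pd_z \<psi>)" z 2] diff that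
    by (simp add: P1_def P_def z2 numeral_2_eq_2)
  \<comment> \<open>The left side of the equation at time t, as a polynomial in z.\<close>
  define Q where "Q = P2 t
       + [:E, - ((n - 1) * (D2 + (n - 2) * G3)):] * P1 t
       + [:G0, G1, G2, G3:] * pderiv (pderiv (P1 t))
       + [:D0, D1, D2:] * pderiv (P1 t)
       + [:F0, F1, F2, F3, F4:] * pderiv (pderiv (pderiv (P t)))
       + [:A0, A1, A2, A3:] * pderiv (pderiv (P t))
       + [:B0, B1, - ((n - 1) * (2 * A3 + 3 * (n - 2) * F4)):] * pderiv (P t)
       + [:n * (- B1 - (n - 1) * (A2 + (n - 2) * F3)),
           n * ((n - 1) * (A3 + 2 * (n - 2) * F4)):] * P t"
  have "poly Q z = 0" for z
    using pde[OF t, of z] unfolding Let_def n_def[symmetric]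
    by (simp only: psi z1 z2 z3 t1 t2 t1z1 t1z2 t)
      (simp add: Q_def algebra_simps power2_eq_square power3_eq_cube power4_eq_xxxx)
  then have "Q = 0" by (simp add: poly_all_0_iff_0[symmetric])
  \<comment> \<open>The power z^(N - k) is the one that carries c_k.\<close>
  then have Q0: "int_coeff Q (int N - k) = 0" by simp
  have coeffs: "int_coeff (P t) i = C (int N - i) t"
      "int_coeff (P1 t) i = tder (C (int N - i)) t"
      "int_coeff (P2 t) i = tder (tder (C (int N - i))) t" for i
    \<comment> \<open>Outside 0..N the functions \<open>C m\<close> are constantly 0, hence so are
      their time derivatives, as \<open>int_coeff_rev_poly\<close> demands.\<close>
    unfolding P_def P1_def P2_def
    by (rule int_coeff_rev_poly; simp add: C_def coeff_ext_eq_const)+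
  show ?case
    unfolding Let_def C_def[symmetric] n_def[symmetric]
    \<comment> \<open>A term z^j times an r-th z-derivative contributes \<open>C (k + j - r)\<close>
      with a falling factorial of r factors starting at N - k - j + r. Here j - r runs from -3 to 1.
      The terms with j - r = 1 combine so that a factor k splits off: for instance D2 receives (n -
      1 - m) - (n - 1) = -m.\<close>
    by (intro trans[OF _ Q0])
      (simp add: Q_def coeffs flip: n_def, simp add: algebra_simps power2_eq_square)
qed

end
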